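(* Let $G$ be a nontrivial additive subgroup of $\mathbb C$ and let $(\widehat W(G),\cdot,[\cdot,\cdot])$ be a transposed Poisson algebra structure defined on the Lie algebra $\widehat W(G)$. Then $(\widehat W(G),\cdot,[\cdot,\cdot])$ is not a Poisson algebra, and there is a family $(a^{d,k})_{d\in G,\,k\in\mathbb Z_+}$ of complex numbers, only finitely many of which are nonzero, such that for all $\alpha,\beta\in G$ and $i,j\in\mathbb Z_+$ $$L_{\alpha,i}\cdot L_{\beta,j}=\sum_{d\in G}\sum_{k\in\mathbb Z_+}a^{d,k}L_{d+\alpha+\beta,\,k+i+j+1}.$$
   Context: All vector spaces are over $\mathbb C$, and $\mathbb Z_+=\{0,1,2,\dots\}$. A transposed Poisson algebra is a vector space with two nonzero bilinear operations $\cdot$ and $[\cdot,\cdot]$ (in particular $\cdot$ is not identically zero) such that $\cdot$ is commutative and associative, $[\cdot,\cdot]$ is a Lie bracket, and $2z\cdot[x,y]=[z\cdot x,y]+[x,z\cdot y]$ for all $x,y,z$. A Poisson algebra is a vector space with a commutative associative product $\cdot$ and a Lie bracket with $[x,y\cdot z]=[x,y]\cdot z+y\cdot[x,z]$. $\widehat W(G)$ is the Lie algebra with basis $\{L_{\alpha,i}\mid\alpha\in G,\ i\in\mathbb Z_+\}\cup\{C\}$, with $C$ central and $$[L_{\alpha,i},L_{\beta,j}]=(\beta-\alpha)L_{\alpha+\beta,i+j}+(j-i)L_{\alpha+\beta,i+j+1}+\delta_{\alpha,-\beta}\delta_{i,-j}\tfrac{\alpha^3-\alpha}{12}C.$$ (Since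 $i,j\ge0$, $\delta_{i,-j}=1$ only when $i=j=0$.) *)

theory Defs
  imports Complex_Main
begin

definition bilinear_op :: "(complex \<Rightarrow> 'v::ab_group_add \<Rightarrow> 'v) \<Rightarrow> ('v \<Rightarrow> 'v \<Rightarrow> 'v) \<Rightarrow> bool" where
  "bilinear_op scale f \<longleftrightarrow>
     (\<forall>x. Vector_Spaces.linear scale scale (\<lambda>y. f x y)) \<and>
     (\<forall>y. Vector_Spaces.linear scale scale (\<lambda>x. f x y))"

locale lie_algebra = vector_space scale
  for scale :: "complex \<Rightarrow> 'v::ab_group_add \<Rightarrow> 'v" +
  fixes bracket :: "'v \<Rightarrow> 'v \<Rightarrow> 'v"
  assumes bracket_bilinear: "bilinear_op scale bracket"
    and bracket_alternating: "bracket x x = 0"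
    and jacobi: "bracket x (bracket y z) + bracket y (bracket z x) + bracket z (bracket x y) = 0"

locale comm_assoc_algebra = vector_space scale
  for scale :: "complex \<Rightarrow> 'v::ab_group_add \<Rightarrow> 'v" +
  fixes mul :: "'v \<Rightarrow> 'v \<Rightarrow> 'v"
  assumes mul_bilinear: "bilinear_op scale mul"
    and mul_commute: "mul x y = mul y x"
    and mul_assoc: "mul (mul x y) z = mul x (mul y z)"

locale poisson_algebra = comm_assoc_algebra scale mul + lie_algebra scale bracket
  for scale :: "complex \<Rightarrow> 'v::ab_group_add \<Rightarrow> 'v"
    and mul :: "'v \<Rightarrow> 'v \<Rightarrow> 'v"
    and bracket :: "'v \<Rightarrow> 'v \<Rightarrow> 'v" +
  assumes leibniz: "bracket x (mul y z) = mul (bracket x y) z + mul y (bracket x z)"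

locale transposed_poisson_algebra = comm_assoc_algebra scale mul + lie_algebra scale bracket
  for scale :: "complex \<Rightarrow> 'v::ab_group_add \<Rightarrow> 'v"
    and mul :: "'v \<Rightarrow> 'v \<Rightarrow> 'v"
    and bracket :: "'v \<Rightarrow> 'v \<Rightarrow> 'v" +
  assumes mul_nonzero: "\<exists>x y. mul x y \<noteq> 0"
    and bracket_nonzero: "\<exists>x y. bracket x y \<noteq> 0"
    and transposed_leibniz:
      "scale 2 (mul z (bracket x y)) = bracket (mul z x) y + bracket x (mul z y)"

definition additive_subgroup :: "complex set \<Rightarrow> bool" where
  "additive_subgroup G \<longleftrightarrow> 0 \<in> G \<and> (\<forall>x\<in>G. \<forall>y\<in>G. x + y \<in> G) \<and> (\<forall>x\<in>G. - x \<in> G)"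

text \<open>
  The Lie algebra is given by its presentation on a basis, so it is fixed up to isomorphism:
  the whole type carries the vector space, and the vectors \<open>L \<alpha> i\<close> with
  \<open>\<alpha> \<in> G\<close> together with \<open>C\<close> are pairwise distinct and form a basis.  The values of \<open>L\<close>
  at first arguments outside \<open>G\<close> are irrelevant.
\<close>

locale W_hat = lie_algebra scale bracket
  for G :: "complex set"
    and scale :: "complex \<Rightarrow> 'v::ab_group_add \<Rightarrow> 'v"
    and bracket :: "'v \<Rightarrow> 'v \<Rightarrow> 'v"
    and L :: "complex \<Rightarrow> nat \<Rightarrow> 'v"
    and C :: 'v +
  assumes L_inj: "inj_on (\<lambda>(\<alpha>, i). L \<alpha> i) (G \<times> UNIV)"
    and C_notin_L: "C \<notin> (\<lambda>(\<alpha>, i). L \<alpha> i) ` (G \<times> UNIV)"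
    and basis_independent: "independent (insert C ((\<lambda>(\<alpha>, i). L \<alpha> i) ` (G \<times> UNIV)))"
    and basis_span: "span (insert C ((\<lambda>(\<alpha>, i). L \<alpha> i) ` (G \<times> UNIV))) = UNIV"
    and C_central: "bracket C x = 0"
    and bracket_L: "\<lbrakk>\<alpha> \<in> G; \<beta> \<in> G\<rbrakk> \<Longrightarrow>
      bracket (L \<alpha> i) (L \<beta> j) =
        scale (\<beta> - \<alpha>) (L (\<alpha> + \<beta>) (i + j))
        + scale (of_nat j - of_nat i) (L (\<alpha> + \<beta>) (i + j + 1))
        + scale (if \<alpha> = - \<beta> \<and> int i = - int j then (\<alpha> ^ 3 - \<alpha>) / 12 else 0) C"

end

theory Submission
  imports Defs "HOL-Library.Poly_Mapping" "HOL-Library.Product_Plus"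
begin

text \<open>
  Modulo \<open>C\<close> the algebra consists of the vector fields \<open>f\<partial>\<close> with \<open>f\<close> in the commutative ring of
  polynomials in \<open>y\<close> and exponentials \<open>e\<^sup>\<alpha>\<close>, where \<open>\<partial>e\<^sup>\<alpha> = \<alpha>e\<^sup>\<alpha>\<close> and \<open>\<partial>y = y\<^sup>2\<close>; here \<open>L \<alpha> i\<close> is
  \<open>e\<^sup>\<alpha>y\<^sup>i\<partial>\<close> and the bracket is \<open>fg' - gf'\<close>.  The transposed Leibniz rule
  says that multiplication by \<open>z\<close> is a half-derivation, \<open>2\<phi>[u, v] = [\<phi>u, v] + [u, \<phi>v]\<close>.
  Subtracting multiplication by a function, one may assume that it kills \<open>L 0 0\<close>, and then
  differential identities between the images of \<open>L \<alpha> i\<close> and \<open>L (- \<alpha>) i\<close> force it to vanish; so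
  every half-derivation is multiplication by a function \<open>a\<close>.  Comparing the \<open>C\<close>-components, the
  cocycle forces \<open>a\<close> to lie in \<open>\<complex> + y(\<dots>)\<close>, with constant term the eigenvalue on \<open>C\<close>, and
  commutativity with \<open>C\<close> removes the constant.  If the Leibniz rule held as well, then \<open>a' = 0\<close> and
  \<open>\<alpha>a = 0\<close> for \<open>\<alpha> \<in> G\<close>, so the product would vanish.
\<close>

subsection \<open>Exponential polynomials\<close>

text \<open>The key \<open>(\<alpha>, i)\<close> stands for \<open>e\<^sup>\<alpha>y\<^sup>i\<close>, so that convolution is multiplication of functions.\<close>
type_synonym expol = "complex \<times> nat \<Rightarrow>\<^sub>0 complex"

definition mon :: "complex \<Rightarrow> nat \<Rightarrow> expol" where
  "mon \<alpha> i = Poly_Mapping.single (\<alpha>, i) 1"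

definition const :: "complex \<Rightarrow> expol" where
  "const c = Poly_Mapping.single 0 c"

lemma const_simps:
  "const 0 = 0" "const 1 = 1" "const (a + b) = const a + const b" "const (a - b) = const a - const b"
  "const (- a) = - const a" "const (a * b) = const a * const b"
  "const (numeral n) = numeral n" "const (of_nat m) = of_nat m"
  by (simp_all add: const_def single_add single_diff single_uminus mult_single flip: one_poly_mapping.abs_eq)

lemma const_mult_mon: "const c * mon \<alpha> i = Poly_Mapping.single (\<alpha>, i) c"
  by (simp add: const_def mon_def mult_single zero_prod_def)

lemma mon_mult: "mon \<alpha> i * mon \<beta> j = mon (\<alpha> + \<beta>) (i + j)"
  by (simp add: mon_def mult_single)

lemma mon_0 [simp]: "mon 0 0 = 1"
  by (simp add: mon_def flip: zero_prod_def)

lemma const_mult_cancel: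
  assumes "c \<noteq> 0" "const c * f = 0"
  shows "f = 0"
proof -
  have "f = const (inverse c) * (const c * f)"
    using assms(1) by (simp flip: mult.assoc const_simps(6) add: const_simps(2))
  then show ?thesis using assms(2) by simp
qed

text \<open>A pure exponential is a unit, with inverse \<open>mon (- \<alpha>) 0\<close>.\<close>

lemma mon_mult_cancel:
  assumes "mon \<alpha> 0 * f = 0"
  shows "f = 0"
proof -
  have "f = mon (- \<alpha>) 0 * (mon \<alpha> 0 * f)"
    by (simp add: mon_mult flip: mult.assoc)
  then show ?thesis using assms by simp
qed

lemma expol_eq_sum_keys: "f = (\<Sum>k\<in>Poly_Mapping.keys f. Poly_Mapping.single k (Poly_Mapping.lookup f k))"
  by (rule poly_mapping_eqI) (simp add: lookup_sum lookup_single when_def in_keys_iff)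

lemma expol_induct [case_names zero add]:
  fixes f :: expol
  assumes "P 0" and "\<And>f \<alpha> i c. P f \<Longrightarrow> P (f + const c * mon \<alpha> i)"
  shows "P f"
proof -
  have "P (\<Sum>k\<in>A. Poly_Mapping.single k (Poly_Mapping.lookup f k))" if "finite A" for A
    using that
  proof induction
    case (insert k A)
    then show ?case
      using assms(2)[of _ "Poly_Mapping.lookup f k" "fst k" "snd k"]
      by (simp add: const_mult_mon) (metis add.commute)
  qed (simp add: assms)
  from this[of "Poly_Mapping.keys f"] show ?thesis by (simp flip: expol_eq_sum_keys)
qed

section \<open>Derivations of exponential polynomials\<close>

text \<open>For additive \<open>h\<close> this is the derivation that scales a monomial by its
  degree \<open>h\<close>; \<open>deriv\<close> combines the degrees given by the exponent and by
  the power of y.\<close>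

definition key_weight :: "(complex \<times> nat \<Rightarrow> complex) \<Rightarrow> expol \<Rightarrow> expol" where
  "key_weight h = Poly_Mapping.mapp (\<lambda>k c. h k * c)"

lemma lookup_key_weight: "Poly_Mapping.lookup (key_weight h f) k = h k * Poly_Mapping.lookup f k"
  by (simp add: key_weight_def lookup_mapp when_def in_keys_iff)

lemma key_weight_add: "key_weight h (f + g) = key_weight h f + key_weight h g"
  by (rule poly_mapping_eqI) (simp add: lookup_key_weight lookup_add algebra_simps)

lemma key_weight_0: "key_weight h 0 = 0"
  by (rule poly_mapping_eqI) (simp add: lookup_key_weight)

lemma key_weight_mon: "key_weight h (const c * mon \<alpha> i) = const (h (\<alpha>, i)) * (const c * mon \<alpha> i)"
proof -
  have "key_weight h (const c * mon \<alpha> i) = const (h (\<alpha>, i) * c) * mon \<alpha> i"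
    by (rule poly_mapping_eqI) (auto simp: lookup_key_weight lookup_single when_def const_mult_mon)
  then show ?thesis by (simp add: const_simps mult.assoc)
qed

lemma key_weight_mult:
  assumes "\<And>k l. h (k + l) = h k + h l"
  shows "key_weight h (f * g) = key_weight h f * g + f * key_weight h g"
proof (induction f rule: expol_induct)
  case (add f \<alpha> i c)
  have "key_weight h (const c * mon \<alpha> i * g) =
      key_weight h (const c * mon \<alpha> i) * g + const c * mon \<alpha> i * key_weight h g"
  proof (induction g rule: expol_induct)
    case (add g \<beta> j d)
    have "key_weight h (const c * mon \<alpha> i * (const d * mon \<beta> j)) = key_weight h (const (c * d) * mon (\<alpha> + \<beta>) (i + j))"
      by (simp add: const_simps mon_mult[symmetric] ac_simps)
    also have "\<dots> = const (h (\<alpha>, i) + h (\<beta>, j)) * (const (c * d) * mon (\<alpha> + \<beta>) (i + j))"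
      using assms[of "(\<alpha>, i)" "(\<beta>, j)"] by (simp add: key_weight_mon)
    also have "\<dots> = key_weight h (const c * mon \<alpha> i) * (const d * mon \<beta> j)
        + const c * mon \<alpha> i * key_weight h (const d * mon \<beta> j)"
      by (simp add: key_weight_mon const_simps mon_mult[symmetric] algebra_simps)
    finally show ?case
      by (simp add: add key_weight_add distrib_left distrib_right)
  qed (simp add: key_weight_0)
  then show ?case by (simp add: add key_weight_add distrib_left distrib_right)
qed (simp add: key_weight_0)

text \<open>The summand with \<open>mon 0 1\<close> comes from \<open>\<partial>y\<^sup>i = i y\<^sup>i\<^sup>+\<^sup>1\<close>.\<close>
definition deriv :: "expol \<Rightarrow> expol" where
  "deriv f = key_weight fst f + mon 0 1 * key_weight (\<lambda>k. of_nat (snd k)) f"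

lemma deriv_0 [simp]: "deriv 0 = 0"
  by (simp add: deriv_def key_weight_0)

lemma deriv_add: "deriv (f + g) = deriv f + deriv g"
  by (simp add: deriv_def key_weight_add algebra_simps)

lemma deriv_mult: "deriv (f * g) = deriv f * g + f * deriv g"
  by (simp add: deriv_def key_weight_mult algebra_simps)

lemma deriv_minus: "deriv (- f) = - deriv f"
  using deriv_add[of f "- f"] by (simp add: eq_neg_iff_add_eq_0 add.commute)

lemma deriv_diff: "deriv (f - g) = deriv f - deriv g"
  using deriv_add[of f "- g"] by (simp add: deriv_minus)

lemma deriv_mon: "deriv (mon \<alpha> i) = const \<alpha> * mon \<alpha> i + of_nat i * mon \<alpha> (i + 1)"
proof -
  have "mon 0 1 * mon \<alpha> i = mon \<alpha> (i + 1)"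
    by (simp add: mon_mult)
  then show ?thesis
    using key_weight_mon[of _ 1 \<alpha> i] by (simp add: deriv_def const_simps mult.left_commute)
qed

lemma deriv_const [simp]: "deriv (const c) = 0"
  using key_weight_mon[of _ c 0 0] by (simp add: deriv_def const_simps)

lemma deriv_1 [simp]: "deriv 1 = 0"
  using deriv_const[of 1] by (simp add: const_simps)

lemma deriv_numeral [simp]: "deriv (numeral n) = 0"
  using deriv_const[of "numeral n"] by (simp add: const_simps)

lemma lookup_mult_mon: "Poly_Mapping.lookup (f * mon \<alpha> i) (\<beta>, j) =
    (if i \<le> j then Poly_Mapping.lookup f (\<beta> - \<alpha>, j - i) else 0)"
proof (induction f rule: expol_induct)
  case (add f \<gamma> k c)
  have "const c * mon \<gamma> k * mon \<alpha> i = const c * mon (\<gamma> + \<alpha>) (k + i)"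
    by (simp add: mon_mult mult.assoc)
  then have "Poly_Mapping.lookup (const c * mon \<gamma> k * mon \<alpha> i) (\<beta>, j) =
      (if i \<le> j then Poly_Mapping.lookup (const c * mon \<gamma> k) (\<beta> - \<alpha>, j - i) else 0)"
    by (auto simp: const_mult_mon lookup_single when_def)
  then show ?case by (simp add: add lookup_add distrib_right)
qed simp


lemma lookup_const_mult: "Poly_Mapping.lookup (const c * f) k = c * Poly_Mapping.lookup f k"
proof (induction f rule: expol_induct)
  case (add f \<alpha> i d)
  have "const c * (const d * mon \<alpha> i) = const (c * d) * mon \<alpha> i"
    by (simp add: const_simps mult.assoc)
  with add show ?case
    by (cases k) (simp add: lookup_add distrib_left const_mult_mon lookup_single when_def)
qed simp

section \<open>The Witt bracket and its half-derivations\<close>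

definition witt :: "expol \<Rightarrow> expol \<Rightarrow> expol" where
  "witt f g = f * deriv g - g * deriv f"

lemma witt_add_left: "witt (f + g) h = witt f h + witt g h"
  and witt_add_right: "witt h (f + g) = witt h f + witt h g"
  and witt_0 [simp]: "witt 0 h = 0" "witt h 0 = 0"
  and witt_const_left: "witt (const c * f) h = const c * witt f h"
  and witt_const_right: "witt h (const c * f) = const c * witt h f"
  by (simp_all add: witt_def deriv_add deriv_mult algebra_simps)

lemma witt_one_left [simp]: "witt 1 f = deriv f"
  by (simp add: witt_def)

lemma witt_mon:
  "witt (mon \<alpha> i) (mon \<beta> j) =
    const (\<beta> - \<alpha>) * mon (\<alpha> + \<beta>) (i + j) + const (of_nat j - of_nat i) * mon (\<alpha> + \<beta>) (i + j + 1)"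
proof -
  have "witt (mon \<alpha> i) (mon \<beta> j) =
      const \<beta> * (mon \<alpha> i * mon \<beta> j) + of_nat j * (mon \<alpha> i * mon \<beta> (j + 1))
      - const \<alpha> * (mon \<alpha> i * mon \<beta> j) - of_nat i * (mon \<alpha> (i + 1) * mon \<beta> j)"
    by (simp add: witt_def deriv_mon algebra_simps)
  then show ?thesis by (simp add: mon_mult const_simps algebra_simps)
qed

text \<open>The two terms containing \<open>deriv a\<close> cancel. Multiplication by a function is
  thus a half-derivation, the model to which all others are compared.\<close>

lemma witt_multiplier: "witt (a * f) g + witt f (a * g) = 2 * (a * witt f g)"
  by (simp add: witt_def deriv_mult algebra_simps)

text \<open>Combining the identity for suitable pairs of exponents yields linear differential
  equations with incompatible coefficients. They force \<open>g\<close> to vanish first at level 0,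
  then at exponent 0, then everywhere.\<close>

lemma half_derivation_vanishes:
  fixes g :: "complex \<Rightarrow> nat \<Rightarrow> expol"
  assumes G: "additive_subgroup G" "G \<noteq> {0}"
    and g_1: "g 0 0 = 0"
    and half: "\<And>\<alpha> \<beta> i j. \<alpha> \<in> G \<Longrightarrow> \<beta> \<in> G \<Longrightarrow>
      2 * (const (\<beta> - \<alpha>) * g (\<alpha> + \<beta>) (i + j) + const (of_nat j - of_nat i) * g (\<alpha> + \<beta>) (i + j + 1))
      = witt (g \<alpha> i) (mon \<beta> j) + witt (mon \<alpha> i) (g \<beta> j)"
    and "\<alpha> \<in> G"
  shows "g \<alpha> i = 0"
proof -
  have minus: "- \<beta> \<in> G" and plus: "\<beta> + \<gamma> \<in> G" if "\<beta> \<in> G" "\<gamma> \<in> G" for \<beta> \<gamma>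
    using G that by (auto simp: additive_subgroup_def)
  have zero: "0 \<in> G" using G by (simp add: additive_subgroup_def)
  \<comment> \<open>The bracket with the constant function 1 is \<open>deriv\<close>, and
    \<open>g 0 0 = 0\<close> removes the other term.\<close>
  have deriv_g: "deriv (g \<beta> j) = 2 * (const \<beta> * g \<beta> j + of_nat j * g \<beta> (j + 1))"
    if "\<beta> \<in> G" for \<beta> j
    using half[OF zero that, of 0 j] g_1 by (simp add: const_simps)
  have level0: "g \<beta> 0 = 0" if \<beta>: "\<beta> \<in> G" for \<beta>
  proof (cases "\<beta> = 0")
    case False
    let ?e = "mon \<beta> 0" and ?e' = "mon (- \<beta>) 0" and ?b = "const \<beta>"
    have D: "deriv (g \<beta> 0) = 2 * ?b * g \<beta> 0" "deriv (g (- \<beta>) 0) = - 2 * ?b * g (- \<beta>) 0"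
      "deriv ?e = ?b * ?e" "deriv ?e' = - ?b * ?e'"
      using deriv_g[of \<beta> 0] deriv_g[of "- \<beta>" 0] \<beta> minus by (simp_all add: const_simps deriv_mon mult.assoc)
    \<comment> \<open>For the exponents \<beta> and -\<beta> the left side of \<open>half\<close> is
      a multiple of \<open>g 0 0\<close>, hence zero.\<close>
    have "const (- 3 * \<beta>) * (?e' * g \<beta> 0 + ?e * g (- \<beta>) 0) = 0"
      using half[OF \<beta> minus[OF \<beta> \<beta>], of 0 0] g_1 unfolding witt_def D const_simps
      by (simp add: const_simps algebra_simps)
    then have *: "?e' * g \<beta> 0 + ?e * g (- \<beta>) 0 = 0"
      using const_mult_cancel[of "- 3 * \<beta>"] False by simp
    \<comment> \<open>The two summands are eigenvectors of \<open>deriv\<close> for \<beta> and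
      -\<beta>, so their difference vanishes along with their sum.\<close>
    have "deriv (?e' * g \<beta> 0 + ?e * g (- \<beta>) 0) = ?b * (?e' * g \<beta> 0) - ?b * (?e * g (- \<beta>) 0)"
      unfolding deriv_add deriv_mult D by (simp add: algebra_simps)
    moreover have "?e * g (- \<beta>) 0 = - (?e' * g \<beta> 0)"
      using * by (simp add: eq_neg_iff_add_eq_0 add.commute)
    ultimately have "const (2 * \<beta>) * (?e' * g \<beta> 0) = 0"
      by (simp add: const_simps mult_ac)
    then have "?e' * g \<beta> 0 = 0"
      by (rule const_mult_cancel[rotated]) (use False in simp)
    then show ?thesis by (rule mon_mult_cancel)
  qed (simp add: g_1)
  \<comment> \<open>\<open>deriv_g\<close> eliminates the term at level \<open>j + 1\<close>, so
    that only level \<open>j\<close> remains.\<close>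
  have recursion: "deriv (g (\<beta> + \<gamma>) j) - 4 * const \<beta> * g (\<beta> + \<gamma>) j =
      mon \<beta> 0 * (deriv (g \<gamma> j) - const \<beta> * g \<gamma> j)"
    if "\<beta> \<in> G" "\<gamma> \<in> G" for \<beta> \<gamma> j
    using half[OF that, of 0 j] deriv_g[OF plus[OF that], of j] level0[OF that(1)]
    by (simp add: const_simps witt_def deriv_mon algebra_simps)
  obtain \<gamma> where \<gamma>: "\<gamma> \<in> G" "\<gamma> \<noteq> 0" using G zero by blast
  have weight0: "g 0 j = 0" for j
  proof -
    \<comment> \<open>Eliminate \<open>?k\<close> and its derivatives from 1, 2 and their derivatives 3, 4.\<close>
    let ?e = "mon \<gamma> 0" and ?e' = "mon (- \<gamma>) 0" and ?b = "const \<gamma>"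
    let ?h = "g 0 j" and ?k = "g (- \<gamma>) j"
    have 1: "deriv ?h - 4 * ?b * ?h = ?e * (deriv ?k - ?b * ?k)"
      using recursion[of \<gamma> "- \<gamma>" j] \<gamma> minus by simp
    have 2: "deriv ?k + 4 * ?b * ?k = ?e' * (deriv ?h + ?b * ?h)"
      using recursion[of "- \<gamma>" 0 j] \<gamma> minus zero by (simp add: const_simps)
    have e: "deriv ?e = ?b * ?e" "deriv ?e' = - ?b * ?e'" "?e * ?e' = 1"
      by (simp_all add: deriv_mon const_simps mon_mult)
    have 3: "deriv (deriv ?h) - 4 * ?b * deriv ?h = ?e * (deriv (deriv ?k) - ?b\<^sup>2 * ?k)"
      using arg_cong[OF 1, of deriv] by (simp add: deriv_diff deriv_mult e algebra_simps power2_eq_square)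
    have 4: "deriv (deriv ?k) + 4 * ?b * deriv ?k = ?e' * (deriv (deriv ?h) - ?b\<^sup>2 * ?h)"
      using arg_cong[OF 2, of deriv] by (simp add: deriv_add deriv_mult e algebra_simps power2_eq_square)
    have ee: "?e * (?e' * x) = x" for x using e(3) by (simp flip: mult.assoc)
    define K where "K = ?e * ?k"
    have K1: "?e * deriv ?k = deriv ?h - 4 * ?b * ?h + ?b * K"
      using 1 by (simp add: K_def algebra_simps)
    have K2: "?e * deriv (deriv ?k) = deriv (deriv ?h) - 4 * ?b * deriv ?h + ?b\<^sup>2 * K"
      using 3 by (simp add: K_def algebra_simps)
    have "?e * (deriv ?k + 4 * ?b * ?k) = deriv ?h + ?b * ?h"
      by (simp only: 2 ee)
    then have "?e * deriv ?k + 4 * ?b * K = deriv ?h + ?b * ?h"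
      by (simp add: K_def algebra_simps)
    \<comment> \<open>All derivatives of \<open>?h\<close> cancel: this amounts to
      \<open>K = ?h\<close>, while the second-order relations below amount to
      \<open>K = 3 * ?h\<close>.\<close>
    then have "?b * (5 * ?b * K) = ?b * (5 * ?b * ?h)"
      unfolding K1 by (simp add: algebra_simps)
    moreover have "?e * (deriv (deriv ?k) + 4 * ?b * deriv ?k) = deriv (deriv ?h) - ?b\<^sup>2 * ?h"
      by (simp only: 4 ee)
    then have "?e * deriv (deriv ?k) + 4 * ?b * (?e * deriv ?k) = deriv (deriv ?h) - ?b\<^sup>2 * ?h"
      by (simp add: algebra_simps)
    then have "5 * ?b\<^sup>2 * K = 15 * ?b\<^sup>2 * ?h"
      unfolding K1 K2 by (simp add: algebra_simps power2_eq_square)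
    ultimately have "10 * (?b * ?b) * ?h = 0"
      by (simp add: algebra_simps power2_eq_square)
    then have "const (10 * (\<gamma> * \<gamma>)) * ?h = 0" by (simp add: const_simps)
    then show ?thesis by (rule const_mult_cancel[rotated]) (use \<gamma> in simp)
  qed
  show ?thesis
  proof (cases "\<alpha> = 0")
    case False
    \<comment> \<open>Passing from exponent 0 to \<alpha> gives the eigenvalue 4\<alpha> of
      \<open>deriv\<close>, passing from \<alpha> back to 0 gives -\<alpha>; both hold only for the
      zero vector.\<close>
    have "deriv (g \<alpha> i) = 4 * const \<alpha> * g \<alpha> i"
      using recursion[OF \<open>\<alpha> \<in> G\<close> zero, of i] weight0 by simp
    moreover have "mon (- \<alpha>) 0 * (deriv (g \<alpha> i) + const \<alpha> * g \<alpha> i) = 0"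
      using recursion[of "- \<alpha>" \<alpha> i] \<open>\<alpha> \<in> G\<close> minus weight0 by (simp add: const_simps)
    then have "deriv (g \<alpha> i) + const \<alpha> * g \<alpha> i = 0" by (rule mon_mult_cancel)
    ultimately have "const (5 * \<alpha>) * g \<alpha> i = 0" by (simp add: const_simps algebra_simps)
    then show ?thesis by (rule const_mult_cancel[rotated]) (use False in simp)
  qed (simp add: weight0)
qed


subsection \<open>Coordinates on the Lie algebra\<close>

lemma bilinear_op_simps:
  assumes "bilinear_op scale f"
  shows "f (x + y) z = f x z + f y z" "f z (x + y) = f z x + f z y"
    "f (scale c x) z = scale c (f x z)" "f z (scale c x) = scale c (f z x)"
    "f 0 z = 0" "f z 0 = 0"
proof -
  interpret l: Vector_Spaces.linear scale scale "\<lambda>x. f x z"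
    using assms by (simp add: bilinear_op_def)
  interpret r: Vector_Spaces.linear scale scale "f z"
    using assms by (simp add: bilinear_op_def)
  show "f (x + y) z = f x z + f y z" "f z (x + y) = f z x + f z y"
    "f (scale c x) z = scale c (f x z)" "f z (scale c x) = scale c (f z x)"
    "f 0 z = 0" "f z 0 = 0"
    by (fact l.add r.add l.scale r.scale l.zero r.zero)+
qed

lemma vector_space_const_mult: "vector_space (\<lambda>c f. const c * f)"
  by unfold_locales (simp_all add: const_simps algebra_simps)

locale W_hat_subgroup = W_hat G scale bracket L C
  for G :: "complex set"
    and scale :: "complex \<Rightarrow> 'v::ab_group_add \<Rightarrow> 'v"
    and bracket :: "'v \<Rightarrow> 'v \<Rightarrow> 'v"
    and L :: "complex \<Rightarrow> nat \<Rightarrow> 'v"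
    and C :: 'v +
  assumes subgroup: "additive_subgroup G"
begin

abbreviation basis :: "'v set" where
  "basis \<equiv> insert C ((\<lambda>(\<alpha>, i). L \<alpha> i) ` (G \<times> UNIV))"

lemmas bracket_simps = bilinear_op_simps[OF bracket_bilinear]

lemma add_closed: "\<alpha> \<in> G \<Longrightarrow> \<beta> \<in> G \<Longrightarrow> \<alpha> + \<beta> \<in> G"
  and uminus_closed: "\<alpha> \<in> G \<Longrightarrow> - \<alpha> \<in> G"
  and zero_closed: "0 \<in> G"
  using subgroup by (simp_all add: additive_subgroup_def)

text \<open>The universal property of the basis, with arbitrary target because it serves both for
  \<open>expol\<close> and for the scalars.\<close>

lemma linear_from_basis:
  assumes "vector_space s"
  obtains h where "Vector_Spaces.linear scale s h" "h C = w" "\<And>\<alpha> i. \<alpha> \<in> G \<Longrightarrow> h (L \<alpha> i) = u \<alpha> i"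
proof -
  interpret target: vector_space s by fact
  interpret vector_space_pair scale s ..
  define f where "f = (\<lambda>b. if b = C then w else case_prod u (inv_into (G \<times> UNIV) (\<lambda>(\<alpha>, i). L \<alpha> i) b))"
  have "f (L \<alpha> i) = u \<alpha> i" "L \<alpha> i \<in> basis" if "\<alpha> \<in> G" for \<alpha> i
    using that inv_into_f_f[OF L_inj, of "(\<alpha>, i)"] C_notin_L by (auto simp: f_def image_iff)
  moreover have "f C = w" by (simp add: f_def)
  ultimately show thesis
    using that[of "construct basis f"] construct_basis[OF basis_independent] linear_construct[OF basis_independent]
    by simp
qed

text \<open>The projection modulo \<open>C\<close> onto coefficients of vector fields;
  \<open>central\<close> below is the complementary coordinate along \<open>C\<close>.\<close>

definition func :: "'v \<Rightarrow> expol" where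
  "func = (SOME h. Vector_Spaces.linear scale (\<lambda>c f. const c * f) h \<and> h C = 0 \<and> (\<forall>\<alpha>\<in>G. \<forall>i. h (L \<alpha> i) = mon \<alpha> i))"

definition central :: "'v \<Rightarrow> complex" where
  "central = (SOME h. Vector_Spaces.linear scale (*) h \<and> h C = 1 \<and> (\<forall>\<alpha>\<in>G. \<forall>i. h (L \<alpha> i) = 0))"

lemma func_linear: "Vector_Spaces.linear scale (\<lambda>c f. const c * f) func"
  and func_C [simp]: "func C = 0"
  and func_L [simp]: "\<alpha> \<in> G \<Longrightarrow> func (L \<alpha> i) = mon \<alpha> i"
proof -
  have "\<exists>h. Vector_Spaces.linear scale (\<lambda>c f. const c * f) h \<and> h C = 0 \<and> (\<forall>\<alpha>\<in>G. \<forall>i. h (L \<alpha> i) = mon \<alpha> i)"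
    by (rule linear_from_basis[OF vector_space_const_mult, of 0 mon]) blast
  from someI_ex[OF this, folded func_def]
  show "Vector_Spaces.linear scale (\<lambda>c f. const c * f) func" "func C = 0"
    "\<alpha> \<in> G \<Longrightarrow> func (L \<alpha> i) = mon \<alpha> i" by auto
qed

lemma central_linear: "Vector_Spaces.linear scale (*) central"
  and central_C [simp]: "central C = 1"
  and central_L [simp]: "\<alpha> \<in> G \<Longrightarrow> central (L \<alpha> i) = 0"
proof -
  have "vector_space ((*) :: complex \<Rightarrow> _)"
    by unfold_locales (simp_all add: algebra_simps)
  then have "\<exists>h. Vector_Spaces.linear scale (*) h \<and> h C = 1 \<and> (\<forall>\<alpha>\<in>G. \<forall>i. h (L \<alpha> i) = 0)"
    by (rule linear_from_basis[of _ 1 "\<lambda>_ _. 0"]) blast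
  from someI_ex[OF this, folded central_def]
  show "Vector_Spaces.linear scale (*) central" "central C = 1"
    "\<alpha> \<in> G \<Longrightarrow> central (L \<alpha> i) = 0" by auto
qed

sublocale func: Vector_Spaces.linear scale "\<lambda>c f. const c * f" func
  by (rule func_linear)

sublocale central: Vector_Spaces.linear scale "(*)" central
  by (rule central_linear)

lemma W_induct [case_names zero L C]:
  assumes "P 0"
    and "\<And>x c \<alpha> i. P x \<Longrightarrow> \<alpha> \<in> G \<Longrightarrow> P (x + scale c (L \<alpha> i))"
    and "\<And>x c. P x \<Longrightarrow> P (x + scale c C)"
  shows "P x"
proof -
  have "x \<in> span basis" by (simp add: basis_span)
  then show ?thesis
    by (induction rule: span_induct_alt) (use assms in \<open>auto simp: add.commute\<close>)
qed

text \<open>\<open>func\<close> records the coefficients at all \<open>L \<alpha> i\<close> and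
  \<open>central\<close> the one at \<open>C\<close>, so together they determine the basis
  representation.\<close>

lemma coordinates_eqI:
  assumes "func x = func y" "central x = central y"
  shows "x = y"
proof -
  have neq: "L \<alpha> i \<noteq> C" "C \<noteq> L \<alpha> i" "L \<alpha> i = L \<beta> j \<longleftrightarrow> \<alpha> = \<beta> \<and> i = j" if "\<alpha> \<in> G" "\<beta> \<in> G" for \<alpha> \<beta> i j
    using that C_notin_L inj_onD[OF L_inj, of "(\<alpha>, i)" "(\<beta>, j)"] by (auto simp: image_iff)
  note representation_simps = representation_add[OF basis_independent] representation_scale[OF basis_independent]
    representation_zero basis_span
  have basis_simps: "representation basis C = (\<lambda>b. if b = C then 1 else 0)"
    "\<alpha> \<in> G \<Longrightarrow> representation basis (L \<alpha> i) = (\<lambda>b. if b = L \<alpha> i then 1 else 0)" for \<alpha> i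
    by (rule representation_basis[OF basis_independent]; auto simp: image_iff)+
  have L: "representation basis x (L \<alpha> i) = Poly_Mapping.lookup (func x) (\<alpha>, i)" if "\<alpha> \<in> G" for x \<alpha> i
    by (induction x rule: W_induct)
       (use that in \<open>auto simp: representation_simps basis_simps neq func.add func.scale func.zero
         lookup_add const_mult_mon lookup_single when_def\<close>)
  have C: "representation basis x C = central x" for x
    by (induction x rule: W_induct)
       (auto simp: representation_simps basis_simps neq central.add central.scale central.zero)
  have "representation basis x b = representation basis y b" if "b \<in> basis" for b
    using that assms by (auto simp: L C)
  then have eq: "representation basis x = representation basis y"
    using representation_ne_zero[of basis x] representation_ne_zero[of basis y] by (intro ext) metis
  have "x = (\<Sum>b | representation basis x b \<noteq> 0. scale (representation basis x b) b)" for x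
    by (rule sum_nonzero_representation_eq[OF basis_independent, symmetric]) (simp add: basis_span)
  from this[of x] this[of y] show ?thesis by (simp only: eq)
qed

text \<open>Needed because \<open>expol\<close> admits all complex exponents, not only those in
  \<open>G\<close>.\<close>

lemma lookup_func_outside: "\<alpha> \<notin> G \<Longrightarrow> Poly_Mapping.lookup (func x) (\<alpha>, i) = 0"
  by (induction x rule: W_induct)
     (auto simp: func.add func.scale func.zero lookup_add const_mult_mon lookup_single when_def)

section \<open>The bracket in coordinates\<close>

lemma bracket_anticommute: "bracket x y = - bracket y x"
  using bracket_alternating[of "x + y"] unfolding bracket_simps(1,2)
  by (simp add: bracket_alternating eq_neg_iff_add_eq_0 add.commute)

lemma bracket_C [simp]: "bracket x C = 0"
  using bracket_anticommute[of x C] by (simp add: C_central)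

text \<open>By bilinearity it suffices to compare basis vectors, where \<open>func\<close> kills the
  cocycle term and \<open>witt_mon\<close> gives the rest.\<close>

lemma func_bracket: "func (bracket x y) = witt (func x) (func y)"
proof (induction x rule: W_induct)
  case (L x c \<alpha> i)
  have "func (bracket (L \<alpha> i) y) = witt (mon \<alpha> i) (func y)"
  proof (induction y rule: W_induct)
    case (L y d \<beta> j)
    have "func (bracket (L \<alpha> i) (L \<beta> j)) = witt (mon \<alpha> i) (mon \<beta> j)"
      using L \<open>\<alpha> \<in> G\<close> add_closed
      by (simp add: bracket_L func.add func.scale witt_mon)
    with L show ?case
      by (simp add: bracket_simps func.add func.scale witt_add_right witt_const_right)
  qed (simp_all add: bracket_simps func.add func.scale func.zero)
  with L show ?case
    by (simp add: bracket_simps func.add func.scale witt_add_left witt_const_left)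
qed (simp_all add: bracket_simps func.add func.scale func.zero C_central)

text \<open>The cocycle pairs \<open>L \<beta> 0\<close> only with \<open>L (- \<beta>) 0\<close>,
  so a single coefficient of \<open>x\<close> contributes.\<close>

lemma central_bracket_L:
  assumes "\<beta> \<in> G"
  shows "central (bracket x (L \<beta> j)) =
    (if j = 0 then Poly_Mapping.lookup (func x) (- \<beta>, 0) * ((\<beta> - \<beta> ^ 3) / 12) else 0)"
proof -
  define w where "w = (\<beta> - \<beta> ^ 3) / 12"
  have "central (bracket x (L \<beta> j)) = (if j = 0 then Poly_Mapping.lookup (func x) (- \<beta>, 0) * w else 0)"
  proof (induction x rule: W_induct)
    case (L x c \<alpha> i)
    have "central (bracket (L \<alpha> i) (L \<beta> j)) = (if \<alpha> = - \<beta> \<and> int i = - int j then (\<alpha> ^ 3 - \<alpha>) / 12 else 0)"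
      using assms add_closed[OF \<open>\<alpha> \<in> G\<close> assms] \<open>\<alpha> \<in> G\<close>
      by (simp only: bracket_L central.add central.scale central_L central_C) simp
    also have "\<dots> = (if j = 0 then Poly_Mapping.lookup (mon \<alpha> i) (- \<beta>, 0) * w else 0)"
      by (auto simp: mon_def lookup_single when_def w_def)
    finally have L_L: "central (bracket (L \<alpha> i) (L \<beta> j)) =
        (if j = 0 then Poly_Mapping.lookup (mon \<alpha> i) (- \<beta>, 0) * w else 0)" .
    have "central (bracket (x + scale c (L \<alpha> i)) (L \<beta> j)) =
        central (bracket x (L \<beta> j)) + c * central (bracket (L \<alpha> i) (L \<beta> j))"
      by (simp only: bracket_simps central.add central.scale)
    moreover have "Poly_Mapping.lookup (func (x + scale c (L \<alpha> i))) (- \<beta>, 0) =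
        Poly_Mapping.lookup (func x) (- \<beta>, 0) + c * Poly_Mapping.lookup (mon \<alpha> i) (- \<beta>, 0)"
      by (simp only: func.add func.scale lookup_add lookup_const_mult func_L[OF \<open>\<alpha> \<in> G\<close>])
    ultimately show ?case
      using L_L L(1) by (cases "j = 0") (simp_all add: distrib_right)
  next
    case (C x c)
    then show ?case
      by (simp add: bracket_simps central.add central.scale central.zero func.add func.scale C_central)
  qed (simp add: bracket_simps central.zero func.zero)
  then show ?thesis by (simp only: w_def)
qed

end

subsection \<open>The transposed Poisson product\<close>

locale transposed_poisson_W_hat =
  W_hat_subgroup G scale bracket L C + transposed_poisson_algebra scale mul bracket
  for G :: "complex set"
    and scale :: "complex \<Rightarrow> 'v::ab_group_add \<Rightarrow> 'v"
    and bracket :: "'v \<Rightarrow> 'v \<Rightarrow> 'v"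
    and L :: "complex \<Rightarrow> nat \<Rightarrow> 'v"
    and C :: 'v
    and mul :: "'v \<Rightarrow> 'v \<Rightarrow> 'v" +
  assumes nontrivial: "G \<noteq> {0}"
begin

section \<open>Multiplication operators modulo the centre\<close>

lemmas mul_simps = bilinear_op_simps[OF mul_bilinear]

text \<open>\<open>L 0 0\<close> corresponds to the function 1, so if multiplication by
  \<open>z\<close> acts modulo \<open>C\<close> as multiplication by a function, that function is
  its value here.\<close>

definition multiplier :: "'v \<Rightarrow> expol" where
  "multiplier z = func (mul z (L 0 0))"

lemma func_transposed_leibniz:
  "2 * func (mul z (bracket x y)) = witt (func (mul z x)) (func y) + witt (func x) (func (mul z y))"
  using arg_cong[OF transposed_leibniz[of z x y], of func]
  by (simp add: func.add func.scale func_bracket const_simps)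

text \<open>Since \<open>C\<close> is central, the image of \<open>mul z C\<close> commutes with all
  vector fields. Testing with 1 makes it constant under \<open>deriv\<close>, and testing with a
  nontrivial exponential makes it zero.\<close>

lemma func_mul_C [simp]: "func (mul z C) = 0"
proof -
  let ?h = "func (mul z C)"
  have *: "witt ?h (func y) = 0" for y
    using func_transposed_leibniz[of z C y] by (simp add: C_central mul_simps func.zero)
  have D: "deriv ?h = 0"
    using *[of "L 0 0"] zero_closed by (simp add: witt_def)
  obtain \<alpha> where \<alpha>: "\<alpha> \<in> G" "\<alpha> \<noteq> 0" using nontrivial zero_closed by blast
  have "mon \<alpha> 0 * (const \<alpha> * ?h) = 0"
    using *[of "L \<alpha> 0"] \<alpha> by (simp add: witt_def D deriv_mon ac_simps)
  then show ?thesis by (rule const_mult_cancel[OF \<alpha>(2) mon_mult_cancel])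
qed

text \<open>The difference \<open>g\<close> of the two sides is again a half-derivation, as
  \<open>witt_multiplier\<close> covers the subtracted part, and it kills
  \<open>L 0 0\<close>.\<close>

lemma func_mul_L:
  assumes "\<alpha> \<in> G"
  shows "func (mul z (L \<alpha> i)) = multiplier z * mon \<alpha> i"
proof -
  define g where "g \<alpha> i = func (mul z (L \<alpha> i)) - multiplier z * mon \<alpha> i" for \<alpha> i
  have func_mul: "func (mul z (L \<alpha> i)) = g \<alpha> i + multiplier z * mon \<alpha> i" for \<alpha> i
    by (simp add: g_def)
  have "g \<alpha> i = 0"
  proof (rule half_derivation_vanishes[OF subgroup nontrivial _ _ assms])
    show "g 0 0 = 0" by (simp add: g_def multiplier_def)
    fix \<alpha> \<beta> i j
    assume \<alpha>\<beta>: "\<alpha> \<in> G" "\<beta> \<in> G"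
    have "2 * (const (\<beta> - \<alpha>) * (g (\<alpha> + \<beta>) (i + j) + multiplier z * mon (\<alpha> + \<beta>) (i + j))
        + const (of_nat j - of_nat i) * (g (\<alpha> + \<beta>) (i + j + 1) + multiplier z * mon (\<alpha> + \<beta>) (i + j + 1)))
      = witt (g \<alpha> i + multiplier z * mon \<alpha> i) (mon \<beta> j) + witt (mon \<alpha> i) (g \<beta> j + multiplier z * mon \<beta> j)"
      using func_transposed_leibniz[of z "L \<alpha> i" "L \<beta> j"] \<alpha>\<beta>
      by (simp only: bracket_L mul_simps func.add func.scale func_mul func_mul_C func_L mult_zero_right add_0_right)
    moreover have "2 * (multiplier z * witt (mon \<alpha> i) (mon \<beta> j)) =
        witt (multiplier z * mon \<alpha> i) (mon \<beta> j) + witt (mon \<alpha> i) (multiplier z * mon \<beta> j)"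
      by (simp add: witt_multiplier)
    ultimately show "2 * (const (\<beta> - \<alpha>) * g (\<alpha> + \<beta>) (i + j) + const (of_nat j - of_nat i) * g (\<alpha> + \<beta>) (i + j + 1))
      = witt (g \<alpha> i) (mon \<beta> j) + witt (mon \<alpha> i) (g \<beta> j)"
      unfolding witt_mon witt_add_left witt_add_right by (simp add: algebra_simps)
  qed
  then show ?thesis by (simp add: g_def)
qed

section \<open>Central components of the product\<close>

text \<open>The \<open>C\<close>-coordinate of the transposed Leibniz rule: on the right the cocycle
  sees only the coefficient of the multiplier at exponent -\<alpha>-\<beta> and level 0.\<close>

lemma central_transposed_leibniz:
  assumes "\<alpha> \<in> G" "\<beta> \<in> G"
  shows "2 * ((\<beta> - \<alpha>) * central (mul z (L (\<alpha> + \<beta>) (i + j)))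
      + (of_nat j - of_nat i) * central (mul z (L (\<alpha> + \<beta>) (i + j + 1)))
      + (if \<alpha> = - \<beta> \<and> i = 0 \<and> j = 0 then (\<alpha> ^ 3 - \<alpha>) / 12 else 0) * central (mul z C)) =
    (if i = 0 \<and> j = 0
     then Poly_Mapping.lookup (multiplier z) (- \<alpha> - \<beta>, 0) * ((\<beta> - \<beta> ^ 3) / 12 - (\<alpha> - \<alpha> ^ 3) / 12) else 0)"
proof -
  have rhs: "central (bracket (mul z (L \<alpha> i)) (L \<beta> j)) - central (bracket (mul z (L \<beta> j)) (L \<alpha> i)) =
    (if i = 0 \<and> j = 0
     then Poly_Mapping.lookup (multiplier z) (- \<alpha> - \<beta>, 0) * ((\<beta> - \<beta> ^ 3) / 12 - (\<alpha> - \<alpha> ^ 3) / 12) else 0)"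
    using assms by (simp add: central_bracket_L func_mul_L lookup_mult_mon right_diff_distrib
        minus_diff_commute[of \<beta> \<alpha>])
  have "int i = - int j \<longleftrightarrow> i = 0 \<and> j = 0" by auto
  then have "central (scale 2 (mul z (bracket (L \<alpha> i) (L \<beta> j)))) =
    2 * ((\<beta> - \<alpha>) * central (mul z (L (\<alpha> + \<beta>) (i + j)))
      + (of_nat j - of_nat i) * central (mul z (L (\<alpha> + \<beta>) (i + j + 1)))
      + (if \<alpha> = - \<beta> \<and> i = 0 \<and> j = 0 then (\<alpha> ^ 3 - \<alpha>) / 12 else 0) * central (mul z C))"
    using assms by (simp only: bracket_L mul_simps central.add central.scale)
  moreover have "central (scale 2 (mul z (bracket (L \<alpha> i) (L \<beta> j)))) =
      central (bracket (mul z (L \<alpha> i)) (L \<beta> j)) - central (bracket (mul z (L \<beta> j)) (L \<alpha> i))"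
    by (simp add: transposed_leibniz central.add central.diff bracket_anticommute[of "L \<alpha> i" "mul z (L \<beta> j)"])
  ultimately show ?thesis by (simp only: rhs)
qed

text \<open>At positive level no cocycle term survives. Fixing the sum \<gamma> of the exponents
  leaves \<alpha> as a free parameter to vary.\<close>

lemma central_mul_L_eq_pos:
  assumes "\<alpha> \<in> G" "\<gamma> \<in> G" "n > 0"
  shows "(\<gamma> - 2 * \<alpha>) * central (mul z (L \<gamma> n)) + of_nat n * central (mul z (L \<gamma> (n + 1))) = 0"
proof -
  have "\<gamma> - \<alpha> \<in> G" using add_closed[OF assms(2) uminus_closed[OF assms(1)]] by simp
  from central_transposed_leibniz[OF assms(1) this, of z 0 n] show ?thesis
    using assms(3) by (simp add: diff_diff_eq) algebra
qed

text \<open>With both levels 0 the term at level 1 has coefficient zero; the factor 24 clears the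
  denominators of the cocycle.\<close>

lemma central_mul_L_eq_0:
  assumes "\<alpha> \<in> G" "\<gamma> \<in> G"
  shows "24 * ((\<gamma> - 2 * \<alpha>) * central (mul z (L \<gamma> 0))) +
      2 * (if \<gamma> = 0 then \<alpha> ^ 3 - \<alpha> else 0) * central (mul z C) =
    Poly_Mapping.lookup (multiplier z) (- \<gamma>, 0) * ((\<gamma> - \<alpha>) - (\<gamma> - \<alpha>) ^ 3 - (\<alpha> - \<alpha> ^ 3))"
proof -
  have "\<gamma> - \<alpha> \<in> G" using add_closed[OF assms(2) uminus_closed[OF assms(1)]] by simp
  then have "2 * ((\<gamma> - 2 * \<alpha>) * central (mul z (L \<gamma> 0))
      + (if \<gamma> = 0 then \<alpha> ^ 3 - \<alpha> else 0) / 12 * central (mul z C)) =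
    Poly_Mapping.lookup (multiplier z) (- \<gamma>, 0) * (((\<gamma> - \<alpha>) - (\<gamma> - \<alpha>) ^ 3) / 12 - (\<alpha> - \<alpha> ^ 3) / 12)"
    using central_transposed_leibniz[OF assms(1), of "\<gamma> - \<alpha>" z 0 0]
    by (cases "\<gamma> = 0") (simp_all add: diff_diff_eq)
  moreover have "24 * x + 2 * y * c = a * (p - q)"
    if "2 * (x + y / 12 * c) = a * (p / 12 - q / 12)" for x y c a p q :: complex
  proof -
    have "12 * (2 * (x + y / 12 * c)) = 12 * (a * (p / 12 - q / 12))" by (simp only: that)
    then show ?thesis by (simp add: distrib_left right_diff_distrib mult.commute)
  qed
  ultimately show ?thesis by blast
qed

text \<open>The unknown central coefficients enter linearly in the parameter while the cocycle has a
  cubic part, so two values of the parameter separate them.\<close>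

lemma central_mul_L [simp]:
  assumes "\<gamma> \<in> G"
  shows "central (mul z (L \<gamma> i)) = 0"
  and lookup_multiplier_0:
    "Poly_Mapping.lookup (multiplier z) (\<gamma>, 0) = (if \<gamma> = 0 then central (mul z C) else 0)"
proof -
  let ?a = "\<lambda>\<delta>. Poly_Mapping.lookup (multiplier z) (\<delta>, 0)"
  obtain \<delta> where \<delta>: "\<delta> \<in> G" "\<delta> \<noteq> 0" using nontrivial zero_closed by blast
  \<comment> \<open>The parameter values 0 and -\<gamma> are compared; three times the first
    relation matches the second except in the cubic term.\<close>
  have off_diagonal: "central (mul z (L \<gamma> 0)) = 0 \<and> ?a (- \<gamma>) = 0" if "\<gamma> \<in> G" "\<gamma> \<noteq> 0" for \<gamma>
  proof -
    let ?f = "central (mul z (L \<gamma> 0))"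
    have 1: "24 * (\<gamma> * ?f) = ?a (- \<gamma>) * (\<gamma> - \<gamma> ^ 3)"
      using central_mul_L_eq_0[of 0 \<gamma> z] that zero_closed by simp
    have "24 * ((\<gamma> - 2 * - \<gamma>) * ?f) =
        ?a (- \<gamma>) * ((\<gamma> - - \<gamma>) - (\<gamma> - - \<gamma>) ^ 3 - (- \<gamma> - (- \<gamma>) ^ 3))"
      using central_mul_L_eq_0[OF uminus_closed[OF that(1)] that(1), of z]
      by (simp only: that(2) if_False mult_zero_left mult_zero_right add_0_right)
    with 1 have "?a (- \<gamma>) * \<gamma> ^ 3 = 0" by algebra
    with that have "?a (- \<gamma>) = 0" by simp
    with 1 that show ?thesis by simp
  qed
  have diagonal: "central (mul z (L 0 0)) = 0 \<and> ?a 0 = central (mul z C)"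
  proof -
    let ?f = "central (mul z (L 0 0))" and ?c = "central (mul z C)"
    have eq: "24 * (\<beta> * ?f) = (?a 0 - ?c) * (\<beta> - \<beta> ^ 3)" if "\<beta> \<in> G" for \<beta>
    proof -
      have "24 * ((0 - 2 * - \<beta>) * ?f) + 2 * ((- \<beta>) ^ 3 - - \<beta>) * ?c =
          ?a 0 * ((0 - - \<beta>) - (0 - - \<beta>) ^ 3 - (- \<beta> - (- \<beta>) ^ 3))"
        using central_mul_L_eq_0[OF uminus_closed[OF that] zero_closed, of z]
        by (simp only: refl if_True minus_zero)
      then show ?thesis by algebra
    qed
    \<comment> \<open>Doubling \<delta> doubles the left side of \<open>eq\<close> but multiplies
      the cubic term by 8.\<close>
    have "24 * (2 * \<delta> * ?f) = (?a 0 - ?c) * (2 * \<delta> - (2 * \<delta>) ^ 3)"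
      using eq[of "2 * \<delta>"] add_closed[OF \<delta>(1) \<delta>(1)] by simp
    with eq[OF \<delta>(1)] have "(?a 0 - ?c) * \<delta> ^ 3 = 0" by algebra
    with \<delta> have "?a 0 - ?c = 0" by simp
    with eq[of \<delta>] \<delta> show ?thesis by simp
  qed
  show "?a \<gamma> = (if \<gamma> = 0 then central (mul z C) else 0)"
    using off_diagonal[of "- \<gamma>"] diagonal assms uminus_closed by simp
  show "central (mul z (L \<gamma> i)) = 0"
  proof (cases "i = 0")
    case True
    then show ?thesis using off_diagonal diagonal assms by (cases "\<gamma> = 0") auto
  next
    case False
    \<comment> \<open>Subtracting the relations for parameters 0 and \<delta> removes the term at
      level \<open>i + 1\<close>.\<close>
    have "(2 * \<delta>) * central (mul z (L \<gamma> i)) = 0"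
      using central_mul_L_eq_pos[of 0 \<gamma> i z] central_mul_L_eq_pos[of \<delta> \<gamma> i z] False assms \<delta> zero_closed
      by algebra
    with \<delta> show ?thesis by simp
  qed
qed

lemma multiplier_C [simp]: "multiplier C = 0"
  by (simp add: multiplier_def mul_commute[of C])

lemma mul_C_L: "\<alpha> \<in> G \<Longrightarrow> mul C (L \<alpha> i) = 0"
  by (rule coordinates_eqI) (simp_all add: func_mul_L func.zero central.zero)

text \<open>The coefficient of \<open>C\<close> in \<open>mul C C\<close> is the constant term of
  \<open>multiplier C\<close>, which is zero.\<close>

lemma mul_C_C: "mul C C = 0"
proof (rule coordinates_eqI)
  show "central (mul C C) = central 0"
    using lookup_multiplier_0[OF zero_closed, of C, symmetric] by (simp add: central.zero)
qed (simp add: func.zero)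

section \<open>The symbol of the product\<close>

text \<open>The function a for which the product modulo \<open>C\<close> sends f and g to
  afg.\<close>

definition symbol :: expol where
  "symbol = multiplier (L 0 0)"

text \<open>Commutativity lets the multiplier of \<open>L \<alpha> i\<close> be computed from that
  of \<open>L 0 0\<close>.\<close>

lemma func_mul_L_L:
  assumes "\<alpha> \<in> G" "\<beta> \<in> G"
  shows "func (mul (L \<alpha> i) (L \<beta> j)) = symbol * mon \<alpha> i * mon \<beta> j"
proof -
  have "multiplier (L \<alpha> i) = func (mul (L 0 0) (L \<alpha> i))"
    unfolding multiplier_def by (rule arg_cong[OF mul_commute])
  also have "\<dots> = symbol * mon \<alpha> i"
    using assms by (simp add: symbol_def func_mul_L)
  finally have "multiplier (L \<alpha> i) = symbol * mon \<alpha> i" .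
  then show ?thesis using assms by (simp add: func_mul_L)
qed

text \<open>The constant term is the coefficient of \<open>C\<close> in
  \<open>mul (L 0 0) C\<close>, which vanishes by commutativity. Divisibility of the symbol by y is
  the source of the shift by 1 in the final formula.\<close>

lemma lookup_symbol_0: "Poly_Mapping.lookup symbol (\<gamma>, 0) = 0"
proof (cases "\<gamma> \<in> G")
  case True
  have "mul (L 0 0) C = 0"
    using mul_commute mul_C_L[OF zero_closed] by metis
  then show ?thesis
    unfolding symbol_def lookup_multiplier_0[OF True] by (simp add: central.zero)
next
  case False
  then show ?thesis
    unfolding symbol_def multiplier_def by (rule lookup_func_outside)
qed

lemma mul_eq_0_if_symbol_0:
  assumes "symbol = 0"
  shows "mul x y = 0"
proof -
  have mul_basis: "mul (L \<alpha> i) (L \<beta> j) = 0" if "\<alpha> \<in> G" "\<beta> \<in> G" for \<alpha> \<beta> i j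
    using that by (intro coordinates_eqI) (simp_all add: func_mul_L_L assms func.zero central.zero)
  show ?thesis
  proof (induction x rule: W_induct)
    case (L x c \<alpha> i)
    have "mul (L \<alpha> i) y = 0"
      by (induction y rule: W_induct)
         (simp_all add: mul_simps mul_basis \<open>\<alpha> \<in> G\<close> mul_commute[of _ C] mul_C_L)
    with L show ?case by (simp add: mul_simps)
  next
    case (C x c)
    have "mul C y = 0"
      by (induction y rule: W_induct) (simp_all add: mul_simps mul_C_L mul_C_C)
    with C show ?case by (simp add: mul_simps)
  qed (simp add: mul_simps)
qed

lemma not_poisson: "\<not> poisson_algebra scale mul bracket"
proof
  assume "poisson_algebra scale mul bracket"
  then interpret poisson_algebra scale mul bracket .
  have E: "func (mul (L 0 0) (L 0 0)) = symbol"
    using func_mul_L_L[of 0 0 0 0] zero_closed by simp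
  have D: "deriv symbol = 0"
    using arg_cong[OF leibniz[of "L 0 0" "L 0 0" "L 0 0"], of func] zero_closed
    by (simp add: bracket_alternating mul_simps func.zero func_bracket E)
  obtain \<alpha> where \<alpha>: "\<alpha> \<in> G" "\<alpha> \<noteq> 0" using nontrivial zero_closed by blast
  have bracket: "bracket (L \<alpha> 0) (L 0 0) = scale (- \<alpha>) (L \<alpha> 0)"
    using \<alpha> zero_closed by (simp add: bracket_L)
  \<comment> \<open>As \<open>deriv symbol = 0\<close>, the left side is -\<alpha> times
    \<open>mon \<alpha> 0 * symbol\<close>, the right side -2\<alpha> times it.\<close>
  have "witt (mon \<alpha> 0) symbol = const (- \<alpha>) * (2 * (symbol * mon \<alpha> 0))"
    using arg_cong[OF leibniz[of "L \<alpha> 0" "L 0 0" "L 0 0"], of func] \<alpha> zero_closed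
    by (simp add: func_bracket E bracket mul_simps func.add func.scale func_mul_L_L mult_ac
        del: scale_minus_left)
  then have "mon \<alpha> 0 * (const \<alpha> * symbol) = 0"
    by (auto simp: witt_def D deriv_mon const_simps algebra_simps)
  then have "symbol = 0"
    by (rule const_mult_cancel[OF \<alpha>(2) mon_mult_cancel])
  then show False using mul_nonzero mul_eq_0_if_symbol_0 by blast
qed

text \<open>The pair \<open>(d, k)\<close> indexes the monomial of the symbol at level
  \<open>Suc k\<close>; level 0 is absent by \<open>lookup_symbol_0\<close>.\<close>

lemma mul_L_L:
  defines "S \<equiv> {(d, k). d \<in> G \<and> Poly_Mapping.lookup symbol (d, Suc k) \<noteq> 0}"
  shows "finite S"
    and "\<alpha> \<in> G \<Longrightarrow> \<beta> \<in> G \<Longrightarrow> mul (L \<alpha> i) (L \<beta> j) =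
      (\<Sum>(d, k)\<in>S. scale (Poly_Mapping.lookup symbol (d, Suc k)) (L (d + \<alpha> + \<beta>) (k + i + j + 1)))"
proof -
  have "S \<subseteq> (\<lambda>(d, k). (d, k - 1)) ` Poly_Mapping.keys symbol"
    by (force simp: S_def in_keys_iff image_iff)
  then show fin: "finite S" by (rule finite_subset) simp
  have symbol: "symbol = (\<Sum>(d, k)\<in>S. const (Poly_Mapping.lookup symbol (d, Suc k)) * mon d (Suc k))"
  proof (rule poly_mapping_eqI)
    fix p :: "complex \<times> nat"
    obtain d k where p: "p = (d, k)" by fastforce
    show "Poly_Mapping.lookup symbol p =
      Poly_Mapping.lookup (\<Sum>(d, k)\<in>S. const (Poly_Mapping.lookup symbol (d, Suc k)) * mon d (Suc k)) p"
    proof (cases k)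
      case 0
      then show ?thesis
        by (simp add: p lookup_symbol_0 lookup_sum case_prod_unfold const_mult_mon lookup_single)
    next
      case (Suc n)
      have "Poly_Mapping.lookup (\<Sum>(d, k)\<in>S. const (Poly_Mapping.lookup symbol (d, Suc k)) * mon d (Suc k)) p
        = (\<Sum>q\<in>S. if q = (d, n) then Poly_Mapping.lookup symbol p else 0)"
        unfolding lookup_sum case_prod_unfold
        by (rule sum.cong) (auto simp: p Suc const_mult_mon lookup_single when_def prod_eq_iff)
      \<comment> \<open>If \<open>(d, n)\<close> is not in \<open>S\<close>, the coefficient is
        zero, either by definition of \<open>S\<close> or because \<open>d\<close> lies outside
        \<open>G\<close>.\<close>
      also have "\<dots> = Poly_Mapping.lookup symbol p"
        using fin lookup_func_outside[of d "mul (L 0 0) (L 0 0)" k]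
        by (auto simp: S_def p Suc symbol_def multiplier_def)
      finally show ?thesis by simp
    qed
  qed
  assume G: "\<alpha> \<in> G" "\<beta> \<in> G"
  show "mul (L \<alpha> i) (L \<beta> j) =
      (\<Sum>(d, k)\<in>S. scale (Poly_Mapping.lookup symbol (d, Suc k)) (L (d + \<alpha> + \<beta>) (k + i + j + 1)))"
  proof (rule coordinates_eqI)
    have "func (mul (L \<alpha> i) (L \<beta> j)) =
      (\<Sum>(d, k)\<in>S. const (Poly_Mapping.lookup symbol (d, Suc k)) * mon d (Suc k)) * mon \<alpha> i * mon \<beta> j"
      unfolding func_mul_L_L[OF G] by (subst symbol) simp
    also have "\<dots> = (\<Sum>(d, k)\<in>S. const (Poly_Mapping.lookup symbol (d, Suc k)) * mon (d + \<alpha> + \<beta>) (k + i + j + 1))"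
      by (simp add: sum_distrib_right case_prod_unfold mult.assoc mon_mult add.assoc)
    also have "\<dots> = func (\<Sum>(d, k)\<in>S. scale (Poly_Mapping.lookup symbol (d, Suc k)) (L (d + \<alpha> + \<beta>) (k + i + j + 1)))"
      using G by (auto simp: func.sum func.scale S_def add_closed intro!: sum.cong)
    finally show "func (mul (L \<alpha> i) (L \<beta> j)) =
      func (\<Sum>(d, k)\<in>S. scale (Poly_Mapping.lookup symbol (d, Suc k)) (L (d + \<alpha> + \<beta>) (k + i + j + 1)))" .
    \<comment> \<open>Both sides are zero: products of the \<open>L\<close> and combinations of the
      \<open>L\<close> have no component along \<open>C\<close>.\<close>
    show "central (mul (L \<alpha> i) (L \<beta> j)) =
      central (\<Sum>(d, k)\<in>S. scale (Poly_Mapping.lookup symbol (d, Suc k)) (L (d + \<alpha> + \<beta>) (k + i + j + 1)))"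
      using G by (auto simp: central.sum central.scale S_def add_closed intro!: sum.neutral)
  qed
qed

end

theorem theorem14:
  fixes G :: "complex set"
    and scale :: "complex \<Rightarrow> 'v::ab_group_add \<Rightarrow> 'v"
    and mul bracket :: "'v \<Rightarrow> 'v \<Rightarrow> 'v"
    and L :: "complex \<Rightarrow> nat \<Rightarrow> 'v"
    and C :: 'v
  assumes "additive_subgroup G" and "G \<noteq> {0}"
    and "W_hat G scale bracket L C"
    and "transposed_poisson_algebra scale mul bracket"
  shows "\<not> poisson_algebra scale mul bracket \<and>
    (\<exists>a :: complex \<Rightarrow> nat \<Rightarrow> complex.
       finite {(d, k). d \<in> G \<and> a d k \<noteq> 0} \<and>
       (\<forall>\<alpha>\<in>G. \<forall>\<beta>\<in>G. \<forall>i j.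
          mul (L \<alpha> i) (L \<beta> j) =
            (\<Sum>(d, k)\<in>{(d, k). d \<in> G \<and> a d k \<noteq> 0}.
               scale (a d k) (L (d + \<alpha> + \<beta>) (k + i + j + 1)))))"
proof -
  interpret W_hat G scale bracket L C by fact
  interpret transposed_poisson_algebra scale mul bracket by fact
  interpret transposed_poisson_W_hat G scale bracket L C mul
    by unfold_locales (fact assms)+
  show ?thesis
  proof (rule conjI[OF not_poisson], rule exI[of _ "\<lambda>d k. Poly_Mapping.lookup symbol (d, Suc k)"],
      rule conjI[OF mul_L_L(1)], intro ballI allI)
  qed (rule mul_L_L(2))
qed

end
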